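(* Up to a constant multiple, the only (jointly) quasinormal $2$-variable weighted shift is the Helton-Howe shift. That is, a $2$-variable weighted shift $W_{(\alpha,\beta)}\equiv(T_1,T_2)$ is (jointly) quasinormal if and only if there exist constants $r_1,r_2>0$ such that $T_1=r_1S_1$ and $T_2=r_2S_2$, where $(S_1,S_2)$ is the Helton-Howe shift.
   Context: Let $\mathbb{Z}_+=\{0,1,2,\dots\}$, let $\{e_{\mathbf{k}}\}_{\mathbf{k}\in\mathbb{Z}_+^2}$ be the canonical orthonormal basis of $\ell^2(\mathbb{Z}_+^2)$, and let $\varepsilon_1=(1,0)$, $\varepsilon_2=(0,1)$. Given bounded families of positive real numbers $\alpha=\{\alpha_{\mathbf{k}}\}$, $\beta=\{\beta_{\mathbf{k}}\}$ ($\mathbf{k}\in\mathbb{Z}_+^2$), the $2$-variable weighted shift $W_{(\alpha,\beta)}\equiv(T_1,T_2)$ is the pair of bounded operators on $\ell^2(\mathbb{Z}_+^2)$ given by $T_1e_{\mathbf{k}}=\alpha_{\mathbf{k}}e_{\mathbf{k}+\varepsilon_1}$ and $T_2e_{\mathbf{k}}=\beta_{\mathbf{k}}e_{\mathbf{k}+\varepsilon_2}$. All $2$-variable weighted shifts are assumed commuting: $T_1T_2=T_2T_1$, i.e. $\beta_{\mathbf{k}+\varepsilon_1}\alpha_{\mathbf{k}}=\alpha_{\mathbf{k}+\varepsilon_2}\beta_{\mathbf{k}}$ for all $\mathbf{k}$. The Helton-Howe shift is the $2$-variable weighted shift all of whose weights $\alpha_{\mathbf{k}},\beta_{\mathbf{k}}$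 equal $1$, i.e. $S_1e_{\mathbf{k}}=e_{\mathbf{k}+\varepsilon_1}$, $S_2e_{\mathbf{k}}=e_{\mathbf{k}+\varepsilon_2}$ (written $(I\otimes U_+,U_+\otimes I)$, with $U_+$ the unweighted unilateral shift on $\ell^2(\mathbb{Z}_+)$). A commuting pair $(T_1,T_2)$ is (jointly) quasinormal if $T_i$ commutes with $T_j^*T_j$ for all $i,j\in\{1,2\}$. *)

theory Defs
  imports "HOL-Analysis.Analysis"
begin

section \<open>The complex Hilbert space of square-summable families\<close>

typedef 'a ell2 = "{x :: 'a \<Rightarrow> complex. (\<lambda>k. (cmod (x k))\<^sup>2) summable_on UNIV}"
  morphisms coord Abs_ell2
  by (rule exI[of _ "\<lambda>_. 0"]) simp

setup_lifting type_definition_ell2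

lemma coord_summable: "(\<lambda>k. (cmod (coord x k))\<^sup>2) summable_on UNIV"
  using coord[of x] by simp

lemma ell2_eqI: "(\<And>k. coord x k = coord y k) \<Longrightarrow> x = y"
  by (simp add: coord_inject[symmetric] fun_eq_iff)

lemma square_summable_add:
  assumes "(\<lambda>k. (cmod (f k))\<^sup>2) summable_on UNIV" "(\<lambda>k. (cmod (g k))\<^sup>2) summable_on UNIV"
  shows "(\<lambda>k. (cmod (f k + g k))\<^sup>2) summable_on UNIV"
proof (rule summable_on_comparison_test)
  show "(\<lambda>k. 2 * (cmod (f k))\<^sup>2 + 2 * (cmod (g k))\<^sup>2) summable_on UNIV"
    by (intro summable_on_add summable_on_cmult_right assms)
  fix k
  have "(cmod (f k + g k))\<^sup>2 \<le> (cmod (f k) + cmod (g k))\<^sup>2"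
    by (intro power_mono norm_triangle_ineq) simp
  also have "\<dots> \<le> 2 * (cmod (f k))\<^sup>2 + 2 * (cmod (g k))\<^sup>2"
    using sum_squares_bound[of "cmod (f k)" "cmod (g k)"] by (simp add: power2_sum)
  finally show "(cmod (f k + g k))\<^sup>2 \<le> 2 * (cmod (f k))\<^sup>2 + 2 * (cmod (g k))\<^sup>2" .
qed simp

lemma square_summable_cmult:
  assumes "(\<lambda>k. (cmod (f k))\<^sup>2) summable_on UNIV"
  shows "(\<lambda>k. (cmod (c * f k))\<^sup>2) summable_on UNIV"
  using summable_on_cmult_right[OF assms, of "(cmod c)\<^sup>2"]
  by (simp add: norm_mult power_mult_distrib)

lift_definition ket :: "'a \<Rightarrow> 'a ell2" is "\<lambda>j k. if k = j then 1 else 0"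
proof -
  fix j :: 'a
  have "(\<lambda>k. (cmod (if k = j then 1 else 0))\<^sup>2) summable_on {j}" by simp
  then show "(\<lambda>k. (cmod (if k = j then 1 else 0))\<^sup>2) summable_on UNIV"
    by (rule summable_on_cong_neutral[THEN iffD1, rotated -1]) auto
qed

lift_definition scaleC :: "complex \<Rightarrow> 'a ell2 \<Rightarrow> 'a ell2" is "\<lambda>c x k. c * x k"
  by (rule square_summable_cmult)

definition cinner :: "'a ell2 \<Rightarrow> 'a ell2 \<Rightarrow> complex" where
  "cinner x y = (\<Sum>\<^sub>\<infinity>k. coord x k * cnj (coord y k))"

lemma cinner_summable: "(\<lambda>k. coord x k * cnj (coord y k)) summable_on UNIV"
proof -
  have "(\<lambda>k. norm (coord x k * cnj (coord y k))) summable_on UNIV"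
    by (rule abs_summable_product)
       (use coord_summable[of x] coord_summable[of y] in \<open>simp_all add: power2_eq_square norm_mult\<close>)
  then show ?thesis by (rule abs_summable_summable)
qed

instantiation ell2 :: (type) real_vector
begin
lift_definition zero_ell2 :: "'a ell2" is "\<lambda>_. 0" by simp
lift_definition plus_ell2 :: "'a ell2 \<Rightarrow> 'a ell2 \<Rightarrow> 'a ell2" is "\<lambda>x y k. x k + y k"
  by (rule square_summable_add)
lift_definition uminus_ell2 :: "'a ell2 \<Rightarrow> 'a ell2" is "\<lambda>x k. - x k" by simp
definition minus_ell2 :: "'a ell2 \<Rightarrow> 'a ell2 \<Rightarrow> 'a ell2" where "minus_ell2 x y = x + - y"
definition scaleR_ell2 :: "real \<Rightarrow> 'a ell2 \<Rightarrow> 'a ell2" where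
  "scaleR_ell2 r x = scaleC (complex_of_real r) x"
lemma coord_simps [simp]:
  "coord 0 k = 0"
  "coord (x + y) k = coord x k + coord y k"
  "coord (- x) k = - coord x k"
  "coord (x - y) k = coord x k - coord y k"
  "coord (scaleC c x) k = c * coord x k"
  "coord (r *\<^sub>R x) k = complex_of_real r * coord x k"
  "coord (ket j) k = (if k = j then 1 else 0)"
  by (simp_all add: minus_ell2_def scaleR_ell2_def zero_ell2.rep_eq plus_ell2.rep_eq
      uminus_ell2.rep_eq scaleC.rep_eq ket.rep_eq)

instance
  by standard (rule ell2_eqI; simp add: algebra_simps)+
end

lemma cinner_add_left: "cinner (x + y) z = cinner x z + cinner y z"
  by (simp add: cinner_def algebra_simps infsum_add cinner_summable)

lemma cinner_scaleC_left: "cinner (scaleC c x) y = c * cinner x y"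
  by (simp add: cinner_def mult.assoc infsum_cmult_right')

lemma cinner_commute: "cinner y x = cnj (cinner x y)"
  unfolding cinner_def infsum_cnj[symmetric] by (intro infsum_cong) simp

lemma cinner_self: "cinner x x = complex_of_real (\<Sum>\<^sub>\<infinity>k. (cmod (coord x k))\<^sup>2)"
proof -
  have "((\<lambda>k. complex_of_real ((cmod (coord x k))\<^sup>2)) has_sum
          complex_of_real (\<Sum>\<^sub>\<infinity>k. (cmod (coord x k))\<^sup>2)) UNIV"
    using has_sum_infsum[OF coord_summable[of x]] by (rule has_sum_of_real)
  then show ?thesis
    unfolding cinner_def complex_norm_square by (rule infsumI)
qed

text \<open>
  The norm and topology come from the real inner product \<open>Re (cinner x y)\<close>, whose norm is the usual
  \<open>\<ell>\<^sup>2\<close> norm (\<open>norm_ell2_square\<close> below).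
\<close>

instantiation ell2 :: (type) real_inner
begin
definition inner_ell2 :: "'a ell2 \<Rightarrow> 'a ell2 \<Rightarrow> real" where "inner_ell2 x y = Re (cinner x y)"
definition norm_ell2 :: "'a ell2 \<Rightarrow> real" where "norm_ell2 x = sqrt (Re (cinner x x))"
definition sgn_ell2 :: "'a ell2 \<Rightarrow> 'a ell2" where "sgn_ell2 x = x /\<^sub>R norm x"
definition dist_ell2 :: "'a ell2 \<Rightarrow> 'a ell2 \<Rightarrow> real" where "dist_ell2 x y = norm (x - y)"
definition uniformity_ell2 :: "('a ell2 \<times> 'a ell2) filter" where
  "uniformity_ell2 = (INF e\<in>{0<..}. principal {(x, y). dist x y < e})"
definition open_ell2 :: "'a ell2 set \<Rightarrow> bool" where
  "open_ell2 U \<longleftrightarrow> (\<forall>x\<in>U. \<forall>\<^sub>F (x', y) in uniformity. x' = x \<longrightarrow> y \<in> U)"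
instance
proof
  fix x y z :: "'a ell2" and r :: real and U :: "'a ell2 set"
  show "sgn x = x /\<^sub>R norm x" by (rule sgn_ell2_def)
  show "dist x y = norm (x - y)" by (rule dist_ell2_def)
  show "(uniformity :: ('a ell2 \<times> 'a ell2) filter) = (INF e\<in>{0<..}. principal {(x, y). dist x y < e})"
    by (rule uniformity_ell2_def)
  show "open U \<longleftrightarrow> (\<forall>x\<in>U. \<forall>\<^sub>F (x', y) in uniformity. x' = x \<longrightarrow> y \<in> U)" by (rule open_ell2_def)
  show "inner x y = inner y x"
    unfolding inner_ell2_def by (subst cinner_commute) simp
  show "inner (x + y) z = inner x z + inner y z"
    by (simp add: inner_ell2_def cinner_add_left)
  show "inner (r *\<^sub>R x) y = r * inner x y"
    by (simp add: inner_ell2_def scaleR_ell2_def cinner_scaleC_left)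
  show "0 \<le> inner x x"
    by (simp add: inner_ell2_def cinner_self infsum_nonneg)
  show "inner x x = 0 \<longleftrightarrow> x = 0"
  proof
    assume "inner x x = 0"
    then have "(\<Sum>\<^sub>\<infinity>k. (cmod (coord x k))\<^sup>2) = 0"
      by (simp add: inner_ell2_def cinner_self)
    then have "(cmod (coord x k))\<^sup>2 = 0" for k
      using nonneg_infsum_le_0D[of "\<lambda>k. (cmod (coord x k))\<^sup>2" UNIV k] coord_summable[of x] by simp
    then show "x = 0" by (intro ell2_eqI) simp
  qed (simp add: inner_ell2_def cinner_def)
  show "norm x = sqrt (inner x x)"
    by (simp add: norm_ell2_def inner_ell2_def)
qed
end

lemma norm_ell2_square: "(norm x)\<^sup>2 = (\<Sum>\<^sub>\<infinity>k. (cmod (coord x k))\<^sup>2)"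
  by (simp add: norm_ell2_def cinner_self infsum_nonneg)


section \<open>Bounded operators and adjoints\<close>

definition bounded_clinear :: "('a ell2 \<Rightarrow> 'b ell2) \<Rightarrow> bool" where
  "bounded_clinear T \<longleftrightarrow> bounded_linear T \<and> (\<forall>c x. T (scaleC c x) = scaleC c (T x))"

text \<open>
  The adjoint is taken with respect to the complex inner product; the library's
  \<^const>\<open>adjoint\<close> refers to the real one.
\<close>

definition adj :: "('a ell2 \<Rightarrow> 'b ell2) \<Rightarrow> 'b ell2 \<Rightarrow> 'a ell2" where
  "adj T = (THE S. bounded_clinear S \<and> (\<forall>x y. cinner (T x) y = cinner x (S y)))"

lemma coord_sum: "coord (sum f F) k = (\<Sum>j\<in>F. coord (f j) k)"
  by (induction F rule: infinite_finite_induct) auto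

lemma ket_expansion: "((\<lambda>k. scaleC (coord x k) (ket k)) has_sum x) UNIV"
proof -
  let ?f = "\<lambda>k. (cmod (coord x k))\<^sup>2"
  have norm_diff: "norm (x - (\<Sum>k\<in>F. scaleC (coord x k) (ket k))) = sqrt (infsum ?f UNIV - sum ?f F)"
    if F: "finite F" for F
  proof -
    have c: "coord (x - (\<Sum>k\<in>F. scaleC (coord x k) (ket k))) j = (if j \<in> F then 0 else coord x j)" for j
      using F by (simp add: coord_sum if_distrib cong: if_cong)
    have "infsum ?f UNIV = infsum ?f F + infsum ?f (- F)"
      using infsum_Un_disjoint[of ?f F "- F"] F
        summable_on_subset_banach[OF coord_summable[of x], of "- F"] by (simp add: Compl_partition)
    moreover have "infsum ?f (- F) = (\<Sum>\<^sub>\<infinity>j. (cmod (if j \<in> F then 0 else coord x j))\<^sup>2)"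
      by (rule infsum_cong_neutral) auto
    ultimately have "(norm (x - (\<Sum>k\<in>F. scaleC (coord x k) (ket k))))\<^sup>2 = infsum ?f UNIV - sum ?f F"
      unfolding norm_ell2_square c using F by simp
    then show ?thesis by (metis norm_ge_zero real_sqrt_unique)
  qed
  have "(sum ?f \<longlongrightarrow> infsum ?f UNIV) (finite_subsets_at_top UNIV)"
    by (rule infsum_tendsto[OF coord_summable])
  then have "((\<lambda>F. sqrt (infsum ?f UNIV - sum ?f F)) \<longlongrightarrow> sqrt (infsum ?f UNIV - infsum ?f UNIV))
      (finite_subsets_at_top UNIV)"
    by (intro tendsto_intros)
  then have "((\<lambda>F. norm (x - (\<Sum>k\<in>F. scaleC (coord x k) (ket k)))) \<longlongrightarrow> 0) (finite_subsets_at_top UNIV)"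
    by (subst tendsto_cong[where g = "\<lambda>F. sqrt (infsum ?f UNIV - sum ?f F)"])
       (auto intro!: eventually_finite_subsets_at_top_weakI norm_diff)
  then have "((\<lambda>F. dist (\<Sum>k\<in>F. scaleC (coord x k) (ket k)) x) \<longlongrightarrow> 0) (finite_subsets_at_top UNIV)"
    by (simp add: dist_norm norm_minus_commute)
  then show ?thesis
    unfolding has_sum_def by (rule tendsto_dist_iff[THEN iffD2])
qed

lemma bounded_linear_eq_on_kets:
  fixes f g :: "'a ell2 \<Rightarrow> 'b :: real_normed_vector"
  assumes f: "bounded_linear f" and g: "bounded_linear g"
    and eq: "\<And>c k. f (scaleC c (ket k)) = g (scaleC c (ket k))"
  shows "f = g"
proof
  fix x
  have "((\<lambda>k. f (scaleC (coord x k) (ket k))) has_sum f x) UNIV"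
    using has_sum_bounded_linear[OF f ket_expansion[of x]] by simp
  moreover have "((\<lambda>k. g (scaleC (coord x k) (ket k))) has_sum g x) UNIV"
    using has_sum_bounded_linear[OF g ket_expansion[of x]] by simp
  ultimately show "f x = g x"
    unfolding eq by (rule has_sum_unique)
qed

lemma cinner_ket_left: "cinner (ket k) x = cnj (coord x k)"
proof -
  have "cinner (ket k) x = (\<Sum>\<^sub>\<infinity>j\<in>{k}. cnj (coord x j))"
    unfolding cinner_def by (rule infsum_cong_neutral) auto
  then show ?thesis by simp
qed

lemma norm_scaleC: "norm (scaleC c x) = cmod c * norm x"
  by (simp add: norm_ell2_def cinner_self norm_mult power_mult_distrib infsum_cmult_right'
      real_sqrt_mult)

lemma cmod_cinner_le: "cmod (cinner x y) \<le> norm x * norm y"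
proof (cases "cinner x y = 0")
  case False
  let ?c = "cnj (cinner x y) / cmod (cinner x y)"
  have "?c * cinner x y = cmod (cinner x y)"
    using False by (simp add: complex_norm_square[symmetric] mult.commute power2_eq_square
        del: complex_mult_cnj) 
  then have "cmod (cinner x y) = inner (scaleC ?c x) y"
    by (simp add: inner_ell2_def cinner_scaleC_left)
  also have "\<dots> \<le> norm (scaleC ?c x) * norm y" by (rule norm_cauchy_schwarz)
  also have "norm (scaleC ?c x) = norm x"
    using False by (simp add: norm_scaleC norm_divide)
  finally show ?thesis .
qed simp

lemma bounded_linear_cinner_left: "bounded_linear (\<lambda>x. cinner x y)"
  by (rule bounded_linear_intro[where K = "norm y"])
     (simp_all add: cinner_add_left scaleR_ell2_def cinner_scaleC_left cmod_cinner_le scaleR_conv_of_real)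

text \<open>Every bounded operator has exactly one adjoint, so the description in \<^const>\<open>adj\<close> is proper.\<close>

lemma adj_ex1:
  fixes T :: "'a ell2 \<Rightarrow> 'b ell2"
  assumes T: "bounded_clinear T"
  shows "\<exists>!S. bounded_clinear S \<and> (\<forall>x y. cinner (T x) y = cinner x (S y))"
proof (rule ex_ex1I)
  have blT: "bounded_linear T" and scT: "\<And>c x. T (scaleC c x) = scaleC c (T x)"
    using T by (auto simp: bounded_clinear_def)
  interpret T: bounded_linear T by fact
  obtain C where C: "\<And>x. norm (T x) \<le> norm x * C" and "0 \<le> C"
    using T.nonneg_bounded by blast
  then have C0: "0 \<le> C * norm y" for y :: "'b ell2" by simp
  define v where "v y k = cnj (cinner (T (ket k)) y)" for y k
  have bd: "(\<Sum>k\<in>F. (cmod (v y k))\<^sup>2) \<le> (C * norm y)\<^sup>2" if F: "finite F" for y F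
  proof -
    define u where "u = (\<Sum>k\<in>F. scaleC (v y k) (ket k))"
    define s where "s = (\<Sum>k\<in>F. (cmod (v y k))\<^sup>2)"
    have cu: "coord u k = (if k \<in> F then v y k else 0)" for k
      using F by (simp add: u_def coord_sum if_distrib cong: if_cong)
    have "(norm u)\<^sup>2 = (\<Sum>\<^sub>\<infinity>k\<in>F. (cmod (v y k))\<^sup>2)"
      unfolding norm_ell2_square cu by (rule infsum_cong_neutral) auto
    then have nu: "(norm u)\<^sup>2 = s" using F by (simp add: s_def)
    interpret c: bounded_linear "\<lambda>x. cinner x y" by (rule bounded_linear_cinner_left)
    have "cinner (T u) y = (\<Sum>k\<in>F. v y k * cinner (T (ket k)) y)"
      by (simp add: u_def T.sum c.sum scT cinner_scaleC_left)
    also have "\<dots> = complex_of_real s"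
      unfolding s_def of_real_sum
      by (rule sum.cong) (simp_all add: v_def complex_norm_square mult.commute del: of_real_power)
    finally have cs: "cinner (T u) y = complex_of_real s" .
    have "0 \<le> s" by (simp add: s_def sum_nonneg)
    then have "s = cmod (cinner (T u) y)" by (simp add: cs)
    also have "\<dots> \<le> norm (T u) * norm y" by (rule cmod_cinner_le)
    also have "\<dots> \<le> norm u * C * norm y" by (intro mult_right_mono C) simp
    finally have "norm u * norm u \<le> norm u * (C * norm y)"
      using nu by (simp add: power2_eq_square mult.assoc)
    then have "norm u \<le> C * norm y"
      using C0[of y] by (cases "norm u = 0") (auto simp: mult_le_cancel_left)
    then have "(norm u)\<^sup>2 \<le> (C * norm y)\<^sup>2" by (rule power_mono) simp
    then show ?thesis by (simp add: nu s_def)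
  qed
  have sum_v: "(\<lambda>k. (cmod (v y k))\<^sup>2) summable_on UNIV" for y
    by (rule nonneg_bdd_above_summable_on) (auto intro!: bdd_aboveI2 bd)
  define S where "S y = Abs_ell2 (v y)" for y
  have cS: "coord (S y) k = v y k" for y k
    by (simp add: S_def Abs_ell2_inverse sum_v)
  have c_right: "cinner x (y + z) = cinner x y + cinner x z"
    "cinner x (scaleC c y) = cnj c * cinner x y" for x y z :: "'b ell2" and c
    by (metis cinner_commute cinner_add_left complex_cnj_add)
       (metis cinner_commute cinner_scaleC_left complex_cnj_mult)
  have S: "bounded_clinear S"
    unfolding bounded_clinear_def
  proof (intro conjI allI)
    show "bounded_linear S"
    proof (rule bounded_linear_intro)
      fix x y :: "'b ell2" and r :: real
      show "S (x + y) = S x + S y"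
        by (rule ell2_eqI) (simp add: cS v_def c_right)
      show "S (r *\<^sub>R x) = r *\<^sub>R S x"
        by (rule ell2_eqI) (simp add: cS v_def scaleR_ell2_def c_right)
      have "(norm (S x))\<^sup>2 \<le> (C * norm x)\<^sup>2"
        unfolding norm_ell2_square cS by (rule infsum_le_finite_sums[OF sum_v]) (rule bd)
      then show "norm (S x) \<le> norm x * C"
        using C0[of x] by (simp add: power2_le_iff_abs_le mult.commute)
    qed
    fix c x show "S (scaleC c x) = scaleC c (S x)"
      by (rule ell2_eqI) (simp add: cS v_def c_right)
  qed
  have "cinner (T x) y = cinner x (S y)" for x y
  proof -
    have "(\<lambda>x. cinner (T x) y) = (\<lambda>x. cinner x (S y))"
      by (rule bounded_linear_eq_on_kets)
         (auto intro: bounded_linear_compose[OF bounded_linear_cinner_left blT]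
           bounded_linear_cinner_left simp: scT cinner_scaleC_left cinner_ket_left cS v_def)
    then show ?thesis by (rule fun_cong)
  qed
  with S show "\<exists>S. bounded_clinear S \<and> (\<forall>x y. cinner (T x) y = cinner x (S y))" by blast
next
  fix S S' :: "'b ell2 \<Rightarrow> 'a ell2"
  assume S: "bounded_clinear S \<and> (\<forall>x y. cinner (T x) y = cinner x (S y))"
    and S': "bounded_clinear S' \<and> (\<forall>x y. cinner (T x) y = cinner x (S' y))"
  then have "cinner (ket k) (S y) = cinner (ket k) (S' y)" for k y by metis
  then show "S = S'"
    by (auto simp: cinner_ket_left intro!: ell2_eqI)
qed


section \<open>Two-variable weighted shifts\<close>

text \<open>
  The addition on \<^typ>\<open>nat \<times> nat\<close> is componentwise, so \<open>k + (1, 0)\<close> and \<open>k + (0, 1)\<close> are the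
  translates of the multi-index \<open>k\<close> by the two unit vectors.
\<close>

definition shift_op :: "nat \<times> nat \<Rightarrow> (nat \<times> nat \<Rightarrow> real) \<Rightarrow> (nat \<times> nat) ell2 \<Rightarrow> (nat \<times> nat) ell2" where
  "shift_op \<epsilon> w = (THE T. bounded_clinear T \<and> (\<forall>k. T (ket k) = w k *\<^sub>R ket (k + \<epsilon>)))"

text \<open>A bounded weight family determines exactly one bounded operator.\<close>

lemma shift_op_ex1:
  fixes w :: "nat \<times> nat \<Rightarrow> real"
  assumes w: "bounded (range w)"
  shows "\<exists>!T. bounded_clinear T \<and> (\<forall>k. T (ket k) = w k *\<^sub>R ket (k + \<epsilon>))"
proof (rule ex_ex1I)
  obtain B where B: "\<And>k. \<bar>w k\<bar> \<le> B" using w by (auto simp: bounded_iff)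
  let ?R = "range (\<lambda>k. k + \<epsilon>)"
  define t where "t x k = (if k \<in> ?R then of_real (w (k - \<epsilon>)) * coord x (k - \<epsilon>) else 0)" for x k
  have inj: "inj (\<lambda>k. k + \<epsilon>)" by (auto simp: inj_on_def prod_eq_iff)
  have diff: "k + \<epsilon> - \<epsilon> = k" for k by (simp add: prod_eq_iff)
  have le: "(cmod (of_real (w k) * coord x k))\<^sup>2 \<le> B\<^sup>2 * (cmod (coord x k))\<^sup>2" for x k
    using B[of k] by (auto simp: norm_mult power_mult_distrib intro!: mult_right_mono power2_le_iff_abs_le[THEN iffD2])
  have sum1: "(\<lambda>k. (cmod (of_real (w k) * coord x k))\<^sup>2) summable_on UNIV" for x
    by (rule summable_on_comparison_test[OF summable_on_cmult_right[OF coord_summable[of x]] le]) simp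
  have sumR: "(\<lambda>k. (cmod (t x k))\<^sup>2) summable_on ?R" for x
    using sum1[of x] by (simp add: summable_on_reindex[OF inj] o_def t_def diff)
  have sumt: "(\<lambda>k. (cmod (t x k))\<^sup>2) summable_on UNIV" for x
    using sumR[of x] by (rule summable_on_cong_neutral[THEN iffD1, rotated -1]) (auto simp: t_def)
  define T where "T x = Abs_ell2 (t x)" for x
  have cT: "coord (T x) k = t x k" for x k by (simp add: T_def Abs_ell2_inverse sumt)
  have "bounded_clinear T"
    unfolding bounded_clinear_def
  proof (intro conjI allI)
    show "bounded_linear T"
    proof (rule bounded_linear_intro)
      fix x y :: "(nat \<times> nat) ell2" and r :: real
      show "T (x + y) = T x + T y"
        by (rule ell2_eqI) (simp add: cT t_def algebra_simps)
      show "T (r *\<^sub>R x) = r *\<^sub>R T x"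
        by (rule ell2_eqI) (simp add: cT t_def)
      have "(norm (T x))\<^sup>2 = (\<Sum>\<^sub>\<infinity>k\<in>?R. (cmod (t x k))\<^sup>2)"
        unfolding norm_ell2_square cT by (rule infsum_cong_neutral) (auto simp: t_def)
      also have "\<dots> = (\<Sum>\<^sub>\<infinity>k. (cmod (of_real (w k) * coord x k))\<^sup>2)"
        by (simp add: infsum_reindex[OF inj] o_def t_def diff)
      also have "\<dots> \<le> (\<Sum>\<^sub>\<infinity>k. B\<^sup>2 * (cmod (coord x k))\<^sup>2)"
        by (intro infsum_mono sum1 summable_on_cmult_right coord_summable le)
      also have "\<dots> = (B * norm x)\<^sup>2"
        by (simp add: infsum_cmult_right' norm_ell2_square power_mult_distrib)
      finally have "(norm (T x))\<^sup>2 \<le> (B * norm x)\<^sup>2" .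
      moreover have "0 \<le> B * norm x" using B[of 0] by (intro mult_nonneg_nonneg) auto
      ultimately show "norm (T x) \<le> norm x * B"
        by (simp add: power2_le_iff_abs_le mult.commute)
    qed
    fix c x show "T (scaleC c x) = scaleC c (T x)"
      by (rule ell2_eqI) (simp add: cT t_def)
  qed
  moreover have "T (ket k) = w k *\<^sub>R ket (k + \<epsilon>)" for k
    by (rule ell2_eqI) (auto simp: cT t_def diff)
  ultimately show "\<exists>T. bounded_clinear T \<and> (\<forall>k. T (ket k) = w k *\<^sub>R ket (k + \<epsilon>))" by blast
next
  fix T T' :: "(nat \<times> nat) ell2 \<Rightarrow> (nat \<times> nat) ell2"
  assume "bounded_clinear T \<and> (\<forall>k. T (ket k) = w k *\<^sub>R ket (k + \<epsilon>))"
    and "bounded_clinear T' \<and> (\<forall>k. T' (ket k) = w k *\<^sub>R ket (k + \<epsilon>))"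
  then show "T = T'"
    by (intro bounded_linear_eq_on_kets) (auto simp: bounded_clinear_def)
qed

type_synonym op_pair =
  "((nat \<times> nat) ell2 \<Rightarrow> (nat \<times> nat) ell2) \<times> ((nat \<times> nat) ell2 \<Rightarrow> (nat \<times> nat) ell2)"

definition weighted_shift :: "(nat \<times> nat \<Rightarrow> real) \<Rightarrow> (nat \<times> nat \<Rightarrow> real) \<Rightarrow> op_pair" where
  "weighted_shift \<alpha> \<beta> = (shift_op (1, 0) \<alpha>, shift_op (0, 1) \<beta>)"

definition helton_howe_shift :: op_pair where
  "helton_howe_shift = weighted_shift (\<lambda>_. 1) (\<lambda>_. 1)"

definition jointly_quasinormal :: "('a ell2 \<Rightarrow> 'a ell2) \<Rightarrow> ('a ell2 \<Rightarrow> 'a ell2) \<Rightarrow> bool" where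
  "jointly_quasinormal T\<^sub>1 T\<^sub>2 \<longleftrightarrow>
     T\<^sub>1 \<circ> T\<^sub>2 = T\<^sub>2 \<circ> T\<^sub>1 \<and>
     (\<forall>A\<in>{T\<^sub>1, T\<^sub>2}. \<forall>B\<in>{T\<^sub>1, T\<^sub>2}. A \<circ> (adj B \<circ> B) = (adj B \<circ> B) \<circ> A)"

end

theory Submission
  imports Defs
begin

text \<open>
  For a weighted shift \<open>B\<close> with weights \<open>w\<close>, the operator \<open>B\<^sup>*B\<close> is diagonal with entries \<open>(w k)\<^sup>2\<close>.
  A shift with positive weights along \<open>\<epsilon>\<close> commutes with it iff \<open>w (k + \<epsilon>) = w k\<close> for all \<open>k\<close>;
  demanding this for both unit vectors \<open>\<epsilon>\<close> makes \<open>w\<close> constant.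
\<close>

lemma
  assumes "bounded (range w)"
  shows bounded_clinear_shift_op: "bounded_clinear (shift_op \<epsilon> w)"
    and shift_op_ket: "shift_op \<epsilon> w (ket k) = w k *\<^sub>R ket (k + \<epsilon>)"
  using theI'[OF shift_op_ex1[OF assms, of \<epsilon>]] unfolding shift_op_def by blast+

lemma
  assumes "bounded_clinear T"
  shows bounded_clinear_adj: "bounded_clinear (adj T)"
    and cinner_adj: "cinner (T x) y = cinner x (adj T y)"
  using theI'[OF adj_ex1[OF assms]] unfolding adj_def by blast+

lemma bounded_clinear_compose:
  assumes "bounded_clinear S" "bounded_clinear T"
  shows "bounded_clinear (S \<circ> T)"
  using assms bounded_linear_compose[of S T] by (simp add: bounded_clinear_def o_def)

lemma scaleC_scaleR: "scaleC c (r *\<^sub>R x) = r *\<^sub>R scaleC c x"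
  by (rule ell2_eqI) simp

lemma bounded_clinear_scaleR:
  assumes "bounded_clinear T"
  shows "bounded_clinear (\<lambda>x. r *\<^sub>R T x)"
  using assms by (auto simp: bounded_clinear_def scaleC_scaleR intro: bounded_linear_const_scaleR)

text \<open>Complex linearity extends agreement from \<open>ket k\<close> to its complex multiples;
  the expansion of a vector in kets and continuity give the rest. Operator identities thus reduce to
  identities between weights.\<close>

lemma bounded_clinear_eqI:
  assumes "bounded_clinear S" "bounded_clinear T" "\<And>k. S (ket k) = T (ket k)"
  shows "S = T"
  using assms by (intro bounded_linear_eq_on_kets) (auto simp: bounded_clinear_def)

lemma bounded_clinear_imp_scaleR:
  "bounded_clinear T \<Longrightarrow> T (r *\<^sub>R x) = r *\<^sub>R T x"
  by (simp add: bounded_clinear_def linear_simps)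

lemma ket_scaleR_cancel: "a *\<^sub>R ket k = b *\<^sub>R ket k \<longleftrightarrow> a = b"
proof
  assume "a *\<^sub>R ket k = b *\<^sub>R ket k"
  then have "coord (a *\<^sub>R ket k) k = coord (b *\<^sub>R ket k) k" by (rule arg_cong)
  then show "a = b" by simp
qed simp

text \<open>Pairing with \<open>ket j\<close> reads off the coordinate at \<open>j\<close> and lets
  the adjoint be moved onto \<open>ket j\<close>. So the adjoint is the backward weighted
  shift.\<close>

lemma coord_adj_shift_op:
  assumes "bounded (range w)"
  shows "coord (adj (shift_op \<epsilon> w) y) j = w j * coord y (j + \<epsilon>)"
proof -
  \<comment> \<open>\<open>cinner\<close> is linear in its first argument, so a ket placed there
    yields the conjugate coordinate.\<close>
  have "cnj (coord (adj (shift_op \<epsilon> w) y) j) = cinner (w j *\<^sub>R ket (j + \<epsilon>)) y"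
    by (simp add: cinner_ket_left[symmetric] shift_op_ket[OF assms, symmetric]
        cinner_adj[OF bounded_clinear_shift_op[OF assms]])
  also have "\<dots> = cnj (w j * coord y (j + \<epsilon>))"
    by (simp add: scaleR_ell2_def cinner_scaleC_left cinner_ket_left)
  finally show ?thesis by (simp only: complex_cnj_cancel_iff)
qed

text \<open>The backward shift undoes the translation by \<epsilon> and contributes the factor
  \<open>w k\<close> a second time.\<close>

lemma adj_shift_op_shift_op_ket:
  assumes "bounded (range w)"
  shows "adj (shift_op \<epsilon> w) (shift_op \<epsilon> w (ket k)) = (w k)\<^sup>2 *\<^sub>R ket k"
  by (rule ell2_eqI)
     (auto simp: coord_adj_shift_op[OF assms] shift_op_ket[OF assms] power2_eq_square)

text \<open>Both products send \<open>ket k\<close> to a multiple of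
  \<open>ket (k + \<epsilon>)\<close>; the diagonal factor is read at \<open>k\<close> if it acts
  before the shift and at \<open>k + \<epsilon>\<close> if it acts after.\<close>

lemma shift_op_commutes_iff:
  assumes v: "bounded (range v)" "\<And>k. 0 < v k" and w: "bounded (range w)" "\<And>k. 0 < w k"
  shows "shift_op \<epsilon> v \<circ> (adj (shift_op \<delta> w) \<circ> shift_op \<delta> w)
       = (adj (shift_op \<delta> w) \<circ> shift_op \<delta> w) \<circ> shift_op \<epsilon> v
     \<longleftrightarrow> (\<forall>k. w (k + \<epsilon>) = w k)" (is "?A \<circ> ?D = ?D \<circ> ?A \<longleftrightarrow> _")
proof -
  have A: "bounded_clinear ?A" and D: "bounded_clinear ?D"
    using v w by (auto intro: bounded_clinear_shift_op bounded_clinear_adj bounded_clinear_compose)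
  have D_ket: "?D (ket k) = (w k)\<^sup>2 *\<^sub>R ket k" for k
    using adj_shift_op_shift_op_ket[OF w(1)] by simp
  have AD: "(?A \<circ> ?D) (ket k) = ((w k)\<^sup>2 * v k) *\<^sub>R ket (k + \<epsilon>)"
    and DA: "(?D \<circ> ?A) (ket k) = ((w (k + \<epsilon>))\<^sup>2 * v k) *\<^sub>R ket (k + \<epsilon>)" for k
    using D_ket[of k] D_ket[of "k + \<epsilon>"]
    by (simp_all only: o_apply[of ?A ?D] o_apply[of ?D ?A] shift_op_ket[OF v(1)] scaleR_scaleR
        bounded_clinear_imp_scaleR[OF A] bounded_clinear_imp_scaleR[OF D] mult.commute)
  have "?A \<circ> ?D = ?D \<circ> ?A \<longleftrightarrow> (\<forall>k. (?A \<circ> ?D) (ket k) = (?D \<circ> ?A) (ket k))"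
    using bounded_clinear_eqI[OF bounded_clinear_compose[OF A D] bounded_clinear_compose[OF D A]]
    by metis
  also have "\<dots> \<longleftrightarrow> (\<forall>k. (w k)\<^sup>2 * v k = (w (k + \<epsilon>))\<^sup>2 * v k)"
    unfolding AD DA ket_scaleR_cancel ..
  \<comment> \<open>\<open>v k\<close> cancels because it is nonzero, and squaring is injective on
    positive weights.\<close>
  also have "\<dots> \<longleftrightarrow> (\<forall>k. w (k + \<epsilon>) = w k)"
    using v(2) w(2) by (metis less_imp_le less_irrefl mult_right_cancel power2_eq_imp_eq)
  finally show ?thesis .
qed

text \<open>Descend from \<open>k\<close> to the origin, first along the first coordinate, then
  along the second.\<close>

lemma constant_if_shift_invariant:
  fixes w :: "nat \<times> nat \<Rightarrow> 'a"
  assumes "\<And>k. w (k + (1, 0)) = w k" "\<And>k. w (k + (0, 1)) = w k"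
  shows "w k = w 0"
proof -
  have "w (m, n) = w (0, n)" for m n
  proof (induction m)
    case (Suc m)
    with assms(1)[of "(m, n)"] show ?case by simp
  qed simp
  moreover have "w (0, n) = w (0, 0)" for n
  proof (induction n)
    case (Suc n)
    with assms(2)[of "(0, n)"] show ?case by simp
  qed simp
  ultimately show ?thesis by (metis surj_pair zero_prod_def)
qed

text \<open>Comparing coefficients on kets turns constancy of the weights into proportionality to
  the unweighted shift.\<close>

lemma shift_op_eq_scaleR_iff:
  assumes w: "bounded (range w)"
  shows "shift_op \<epsilon> w = (\<lambda>x. r *\<^sub>R shift_op \<epsilon> (\<lambda>_. 1) x) \<longleftrightarrow> (\<forall>k. w k = r)"
proof -
  have 1: "bounded (range (\<lambda>_ :: nat \<times> nat. 1 :: real))" by simp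
  have "shift_op \<epsilon> w = (\<lambda>x. r *\<^sub>R shift_op \<epsilon> (\<lambda>_. 1) x)
    \<longleftrightarrow> (\<forall>k. shift_op \<epsilon> w (ket k) = r *\<^sub>R shift_op \<epsilon> (\<lambda>_. 1) (ket k))"
    using bounded_clinear_eqI[OF bounded_clinear_shift_op[OF w]
        bounded_clinear_scaleR[OF bounded_clinear_shift_op[OF 1]]] by metis
  then show ?thesis
    by (simp only: shift_op_ket[OF w] shift_op_ket[OF 1] scaleR_scaleR mult_1_right ket_scaleR_cancel)
qed

theorem theorem3p3:
  fixes \<alpha> \<beta> :: "nat \<times> nat \<Rightarrow> real"
    and T\<^sub>1 T\<^sub>2 S\<^sub>1 S\<^sub>2 :: "(nat \<times> nat) ell2 \<Rightarrow> (nat \<times> nat) ell2"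
  assumes pos: "\<And>k. 0 < \<alpha> k" "\<And>k. 0 < \<beta> k"
    and bdd: "bounded (range \<alpha>)" "bounded (range \<beta>)"
    and shift: "(T\<^sub>1, T\<^sub>2) = weighted_shift \<alpha> \<beta>"
    and comm: "T\<^sub>1 \<circ> T\<^sub>2 = T\<^sub>2 \<circ> T\<^sub>1"
    and hh: "(S\<^sub>1, S\<^sub>2) = helton_howe_shift"
  shows "jointly_quasinormal T\<^sub>1 T\<^sub>2 \<longleftrightarrow>
    (\<exists>r\<^sub>1 r\<^sub>2 :: real. r\<^sub>1 > 0 \<and> r\<^sub>2 > 0 \<and> T\<^sub>1 = (\<lambda>x. r\<^sub>1 *\<^sub>R S\<^sub>1 x) \<and> T\<^sub>2 = (\<lambda>x. r\<^sub>2 *\<^sub>R S\<^sub>2 x))"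
proof -
  have T: "T\<^sub>1 = shift_op (1, 0) \<alpha>" "T\<^sub>2 = shift_op (0, 1) \<beta>"
    using shift by (simp_all add: weighted_shift_def)
  have S: "S\<^sub>1 = shift_op (1, 0) (\<lambda>_. 1)" "S\<^sub>2 = shift_op (0, 1) (\<lambda>_. 1)"
    using hh by (simp_all add: helton_howe_shift_def weighted_shift_def)
  \<comment> \<open>The four choices of the two operators give invariance of each weight family
    under each unit vector.\<close>
  have "jointly_quasinormal T\<^sub>1 T\<^sub>2 \<longleftrightarrow>
      (\<forall>k. \<alpha> (k + (1, 0)) = \<alpha> k) \<and> (\<forall>k. \<beta> (k + (1, 0)) = \<beta> k) \<and>
      (\<forall>k. \<alpha> (k + (0, 1)) = \<alpha> k) \<and> (\<forall>k. \<beta> (k + (0, 1)) = \<beta> k)"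
    using comm
    by (simp only: jointly_quasinormal_def T ball_simps shift_op_commutes_iff bdd pos simp_thms conj_assoc)
  also have "\<dots> \<longleftrightarrow> (\<forall>k. \<alpha> k = \<alpha> 0) \<and> (\<forall>k. \<beta> k = \<beta> 0)"
    using constant_if_shift_invariant[of \<alpha>] constant_if_shift_invariant[of \<beta>] by metis
  \<comment> \<open>The constants are the weights at the origin, hence positive.\<close>
  also have "\<dots> \<longleftrightarrow> (\<exists>r\<^sub>1 r\<^sub>2. r\<^sub>1 > 0 \<and> r\<^sub>2 > 0 \<and> (\<forall>k. \<alpha> k = r\<^sub>1) \<and> (\<forall>k. \<beta> k = r\<^sub>2))"
    using pos by metis
  finally show ?thesis
    by (simp only: T S shift_op_eq_scaleR_iff bdd)
qed

end
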